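(* Let $G\not\equiv0$ be an infinitesimal generator in $\mathbb{D}$ with Denjoy-Wolff point $\tau\in\overline{\mathbb{D}}$, and let $\hat{G}$ be its dual infinitesimal generator. Let $x\in\partial\mathbb{D}\setminus\{\tau\}$ and $\ell\in(0,+\infty)$. Then the following are equivalent: (1) $x$ is a boundary regular null point for $G$ of dilation $\ell$, where $\ell=\lim_{(0,1)\ni r\to1}|G(rx)|/(1-r)>0$; (2) $x$ is a regular pole for $\hat{G}$ of mass $|\tau-x|^4/\ell$.
   Context: $\mathbb{D}$ is the open unit disc in $\mathbb{C}$. A semigroup $(\phi_t)_{t\ge0}$ of holomorphic self-maps of $\mathbb{D}$ is a family of holomorphic maps $\phi_t:\mathbb{D}\to\mathbb{D}$ with $\phi_0=\mathrm{id}$, $\phi_{t+s}=\phi_t\circ\phi_s$, and $t\mapsto\phi_t$ continuous for uniform convergence on compacta. Its infinitesimal generator is the unique holomorphic $G:\mathbb{D}\to\mathbb{C}$ with $\partial_t\phi_t(z)=G(\phi_t(z))$ for all $t\ge 0$, $z\in\mathbb D$; an infinitesimal generator in $\mathbb D$ is a $G$ arising this way. Berkson-Porta formula: if $G\not\equiv0$ there are a unique $\tau\in\overline{\mathbb{D}}$ (the Denjoy-Wolff point) and a unique holomorphic $p:\mathbb{D}\to\mathbb{C}$ with $\mathrm{Re}\,p\ge0$ such that $G(z)=(\tau-z)(1-\overline{\tau}z)p(z)$. The dual infinitesimal generator of $G\not\equiv 0$ is $\hat{G}(z):=(\tau-z)(1-\overline{\tau}z)\frac1{p(z)}$ (it is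 again an infinitesimal generator, with the same $\tau$). $\angle\lim$ and $\angle\liminf$ denote non-tangential limit and lower limit, i.e. taken as $z\to x$ inside Stolz angles $\{z\in\mathbb{D}:|x-z|<R(1-|z|)\}$, $R>1$. A boundary regular null point for $G$ is a point $x\in\partial\mathbb{D}$ such that $\angle\lim_{z\to x}\frac{G(z)}{z-x}=\ell\in\mathbb{R}$ exists and is finite; $\ell$ is called the dilation of $G$ at $x$. A point $x\in\partial\mathbb{D}$ is a regular pole of mass $C>0$ of an infinitesimal generator $F$ if $\angle\liminf_{z\to x}|F(z)(x-z)|=C\in(0,+\infty)$. *)

theory Defs
  imports "HOL-Complex_Analysis.Complex_Analysis" "HOL-Library.Extended_Real"
begin

abbreviation unit_disc :: "complex set" where
  "unit_disc \<equiv> ball 0 1"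

text \<open>Only the values \<open>\<phi> t z\<close> with \<open>t \<ge> 0\<close> and \<open>z\<close> in the disc are relevant. The last conjunct is
  continuity of \<open>t \<mapsto> \<phi> t\<close> for uniform convergence on compacta.\<close>

definition holomorphic_semigroup :: "(real \<Rightarrow> complex \<Rightarrow> complex) \<Rightarrow> bool" where
  "holomorphic_semigroup \<phi> \<longleftrightarrow>
     (\<forall>t\<ge>0. \<phi> t holomorphic_on unit_disc \<and> \<phi> t ` unit_disc \<subseteq> unit_disc) \<and>
     (\<forall>z\<in>unit_disc. \<phi> 0 z = z) \<and>
     (\<forall>t\<ge>0. \<forall>s\<ge>0. \<forall>z\<in>unit_disc. \<phi> (t + s) z = \<phi> t (\<phi> s z)) \<and>
     (\<forall>K. compact K \<and> K \<subseteq> unit_disc \<longrightarrow>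
        (\<forall>t\<ge>0. uniform_limit K \<phi> (\<phi> t) (at t within {0..})))"

definition infinitesimal_generator :: "(complex \<Rightarrow> complex) \<Rightarrow> bool" where
  "infinitesimal_generator G \<longleftrightarrow>
     G holomorphic_on unit_disc \<and>
     (\<exists>\<phi>. holomorphic_semigroup \<phi> \<and>
        (\<forall>t\<ge>0. \<forall>z\<in>unit_disc.
           ((\<lambda>s. \<phi> s z) has_vector_derivative G (\<phi> t z)) (at t within {0..})))"

definition berkson_porta :: "(complex \<Rightarrow> complex) \<Rightarrow> complex \<Rightarrow> (complex \<Rightarrow> complex) \<Rightarrow> bool" where
  "berkson_porta G \<tau> p \<longleftrightarrow>
     \<tau> \<in> cball 0 1 \<and> p holomorphic_on unit_disc \<and> (\<forall>z\<in>unit_disc. 0 \<le> Re (p z)) \<and>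
     (\<forall>z\<in>unit_disc. G z = (\<tau> - z) * (1 - cnj \<tau> * z) * p z)"

text \<open>For a generator \<open>G\<close> that is not identically zero, the Berkson-Porta theorem says that \<open>\<tau>\<close> exists
  and is unique, and that \<open>p\<close> exists and is unique on the disc. The Denjoy-Wolff point and the dual
  generator are therefore given as relations; the latter fixes the dual on the disc only.\<close>

definition denjoy_wolff_point :: "(complex \<Rightarrow> complex) \<Rightarrow> complex \<Rightarrow> bool" where
  "denjoy_wolff_point G \<tau> \<longleftrightarrow> (\<exists>p. berkson_porta G \<tau> p)"

text \<open>For \<open>G\<close> not identically zero, \<open>p\<close> has no zero in the disc (open mapping), so the quotient is
  a genuine one.\<close>

definition dual_generator ::
    "(complex \<Rightarrow> complex) \<Rightarrow> complex \<Rightarrow> (complex \<Rightarrow> complex) \<Rightarrow> bool" where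
  "dual_generator G \<tau> H \<longleftrightarrow>
     (\<exists>p. berkson_porta G \<tau> p \<and>
        (\<forall>z\<in>unit_disc. H z = (\<tau> - z) * (1 - cnj \<tau> * z) * (1 / p z)))"

definition stolz_angle :: "complex \<Rightarrow> real \<Rightarrow> complex set" where
  "stolz_angle x R = {z \<in> unit_disc. cmod (x - z) < R * (1 - cmod z)}"

definition has_angular_limit :: "(complex \<Rightarrow> complex) \<Rightarrow> complex \<Rightarrow> complex \<Rightarrow> bool" where
  "has_angular_limit f x L \<longleftrightarrow> (\<forall>R>1. (f \<longlongrightarrow> L) (at x within stolz_angle x R))"

text \<open>As for angular limits, the value is required to be the same in every Stolz angle.\<close>

definition has_angular_liminf :: "(complex \<Rightarrow> real) \<Rightarrow> complex \<Rightarrow> real \<Rightarrow> bool" where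
  "has_angular_liminf f x C \<longleftrightarrow>
     (\<forall>R>1. Liminf (at x within stolz_angle x R) (\<lambda>z. ereal (f z)) = ereal C)"

definition boundary_regular_null_point :: "(complex \<Rightarrow> complex) \<Rightarrow> complex \<Rightarrow> real \<Rightarrow> bool" where
  "boundary_regular_null_point G x l \<longleftrightarrow>
     x \<in> sphere 0 1 \<and> has_angular_limit (\<lambda>z. G z / (z - x)) x (complex_of_real l)"

definition regular_pole :: "(complex \<Rightarrow> complex) \<Rightarrow> complex \<Rightarrow> real \<Rightarrow> bool" where
  "regular_pole F x C \<longleftrightarrow>
     x \<in> sphere 0 1 \<and> 0 < C \<and> has_angular_liminf (\<lambda>z. cmod (F z * (x - z))) x C"

end

theory Submission imports Defs begin

text \<open>With \<open>m z = (\<tau> - z) (1 - cnj \<tau> z)\<close> one has \<open>(Ghat z (x - z)) (G z / (z - x)) = - (m z)\<^sup>2\<close>,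
  and \<open>m x = - x |\<tau> - x|\<^sup>2\<close> is nonzero, so an angular limit of one factor gives one of the other.
  The null point condition is already a limit. The pole condition is only a lower limit of a modulus,
  but by a Julia--Wolff--Caratheodory theorem for \<open>q = 1 / p\<close>, which has nonnegative real part,
  \<open>q z (x - z)\<close> always has an angular limit of the form \<open>c x\<close> with \<open>c \<ge> 0\<close>; hence the value of the
  lower limit determines \<open>c\<close>, phase included.\<close>

section \<open>Schwarz--Pick estimate for the right half-plane\<close>

lemma one_minus_cnj_mult_nonzero:
  fixes w z :: complex
  assumes "cmod w < 1" "cmod z < 1"
  shows "1 - cnj w * z \<noteq> 0"
proof
  assume "1 - cnj w * z = 0"
  then have "cmod w * cmod z = 1"
    by (metis complex_mod_cnj norm_mult norm_one right_minus_eq)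
  moreover have "cmod w * cmod z < 1"
    using assms by (metis norm_mult norm_mult_less mult_1)
  ultimately show False by simp
qed

text \<open>Dividing by \<open>(cmod (1 - cnj w * z))\<^sup>2\<close> evaluates one minus the
  squared pseudohyperbolic distance of \<open>w\<close> and \<open>z\<close>.\<close>

lemma cmod_moebius_identity:
  "(cmod (1 - cnj w * z))\<^sup>2 - (cmod (z - w))\<^sup>2 = (1 - (cmod w)\<^sup>2) * (1 - (cmod z)\<^sup>2)"
  by (simp add: cmod_power2) (simp add: power2_eq_square algebra_simps)

text \<open>Moving \<open>w\<close> and \<open>f w\<close> to 0 by conformal maps of disc and
  half-plane reduces this to the Schwarz lemma. The later use relies on the bound being linear in
  \<open>Re (f w)\<close>: a small real part at a single point controls \<open>f\<close>
  everywhere.\<close>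

lemma schwarz_pick_right_half_plane:
  assumes holf: "f holomorphic_on unit_disc"
    and pos: "\<And>z. z \<in> unit_disc \<Longrightarrow> 0 < Re (f z)"
    and w: "w \<in> unit_disc" and z: "z \<in> unit_disc"
  shows "cmod (f z - f w)
           \<le> 4 * Re (f w) * (cmod (1 - cnj w * z))\<^sup>2 / ((1 - (cmod z)\<^sup>2) * (1 - (cmod w)\<^sup>2))"
proof -
  \<comment> \<open>\<open>M\<close> is the disc automorphism with \<open>M 0 = w\<close>, and
    \<open>g\<close> follows \<open>f \<circ> M\<close> by the Cayley-type map from the right
    half-plane to the disc that sends \<open>f w\<close> to 0. The modulus of \<rho> is the
    pseudohyperbolic distance of \<open>w\<close> and \<open>z\<close>.\<close>
  define M where "M = Moebius_function 0 (- w)"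
  define g where "g u = (f (M u) - f w) / (f (M u) + cnj (f w))" for u
  define \<rho> where "\<rho> = Moebius_function 0 w z"
  have w1: "cmod w < 1" and z1: "cmod z < 1" using w z by auto
  have M_in: "M u \<in> unit_disc" if "cmod u < 1" for u
    using Moebius_function_norm_lt_1[of "- w" u 0] that w1 by (simp add: M_def)
  have ne: "a + cnj (f w) \<noteq> 0" if "0 < Re a" for a
    using that pos[OF w] by (auto simp: complex_eq_iff)
  have "M holomorphic_on unit_disc"
    unfolding M_def using w1 by (intro Moebius_function_holomorphic) auto
  then have "(f \<circ> M) holomorphic_on unit_disc"
    using M_in by (intro holomorphic_on_compose_gen[OF _ holf]) auto
  then have holg: "g holomorphic_on unit_disc"
    unfolding g_def o_def by (intro holomorphic_intros) (use M_in pos ne in auto)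
  have g0: "g 0 = 0"
    by (simp add: g_def M_def Moebius_function_of_zero)
  have "cmod (a - f w) < cmod (a + cnj (f w))" if "0 < Re a" for a
  proof -
    have "(cmod (a + cnj (f w)))\<^sup>2 - (cmod (a - f w))\<^sup>2 = 4 * Re a * Re (f w)"
      by (simp add: cmod_power2) (simp add: power2_eq_square algebra_simps)
    moreover have "0 < 4 * Re a * Re (f w)" using that pos[OF w] by simp
    ultimately show ?thesis by (intro power2_less_imp_less[of _ "cmod (a + cnj (f w))"]) auto
  qed
  then have g1: "cmod (g u) < 1" if "cmod u < 1" for u
    using pos[OF M_in[OF that]] ne[of "f (M u)"] by (simp add: g_def norm_divide divide_simps)
  have \<rho>1: "cmod \<rho> < 1"
    unfolding \<rho>_def using w1 z1 by (rule Moebius_function_norm_lt_1)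
  have "M \<rho> = z"
    unfolding M_def \<rho>_def using w1 z1 by (intro Moebius_function_compose) auto
  then have "cmod ((f z - f w) / (f z + cnj (f w))) \<le> cmod \<rho>"
    using Schwarz_Lemma(1)[OF holg g0 g1 \<rho>1] by (simp add: g_def)
  then have "cmod (f z - f w) \<le> cmod \<rho> * cmod (f z + cnj (f w))"
    using ne[OF pos[OF z]] by (simp add: norm_divide divide_simps)
  \<comment> \<open>Replacing the denominator by \<open>f z - f w\<close>, at the cost of
    \<open>2 * Re (f w)\<close>, lets the unknown difference be absorbed on the left.\<close>
  also have "\<dots> \<le> cmod \<rho> * (cmod (f z - f w) + 2 * Re (f w))"
  proof (rule mult_left_mono)
    have "f z + cnj (f w) = (f z - f w) + of_real (2 * Re (f w))"
      by (simp add: complex_eq_iff)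
    then show "cmod (f z + cnj (f w)) \<le> cmod (f z - f w) + 2 * Re (f w)"
      using norm_triangle_ineq[of "f z - f w" "of_real (2 * Re (f w))"] pos[OF w]
      by (simp only: norm_of_real abs_of_pos mult_pos_pos zero_less_numeral)
  qed simp
  finally have le: "cmod (f z - f w) * (1 - cmod \<rho>) \<le> 2 * Re (f w) * cmod \<rho>"
    by (simp add: algebra_simps)
  \<comment> \<open>The extra factor \<open>1 + cmod \<rho> \<le> 2\<close> doubles the constant to
    4 but produces \<open>1 - (cmod \<rho>)\<^sup>2\<close>, which the Moebius identity computes
    exactly.\<close>
  have "cmod (f z - f w) * (1 - (cmod \<rho>)\<^sup>2)
      = (cmod (f z - f w) * (1 - cmod \<rho>)) * (1 + cmod \<rho>)"
    by (simp add: power2_eq_square algebra_simps)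
  also have "\<dots> \<le> (2 * Re (f w) * cmod \<rho>) * (1 + cmod \<rho>)"
    using le by (rule mult_right_mono) simp
  also have "\<dots> \<le> (2 * Re (f w) * 1) * 2"
    using \<rho>1 pos[OF w] by (intro mult_mono) auto
  finally have main: "cmod (f z - f w) * (1 - (cmod \<rho>)\<^sup>2) \<le> 4 * Re (f w)"
    by simp
  define D where "D = (cmod (1 - cnj w * z))\<^sup>2"
  have D: "0 < D" using one_minus_cnj_mult_nonzero[OF w1 z1] by (simp add: D_def)
  have "(cmod \<rho>)\<^sup>2 = (cmod (z - w))\<^sup>2 / D"
    by (simp add: \<rho>_def D_def Moebius_function_simple norm_divide power_divide)
  then have eq: "1 - (cmod \<rho>)\<^sup>2 = (1 - (cmod w)\<^sup>2) * (1 - (cmod z)\<^sup>2) / D"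
    using cmod_moebius_identity[of w z] D by (simp add: D_def field_simps)
  have "0 < (1 - (cmod w)\<^sup>2) * (1 - (cmod z)\<^sup>2)"
    using w1 z1 by (simp add: abs_square_less_1)
  then show ?thesis
    using main D unfolding eq D_def[symmetric] by (simp add: field_simps)
qed

section \<open>Functions with nonnegative real part: boundary behaviour and zeros\<close>

lemma Re_cayley:
  assumes "cmod x = 1"
  shows "Re ((x + z) / (x - z)) = (1 - (cmod z)\<^sup>2) / (cmod (x - z))\<^sup>2"
proof -
  have "(Re x)\<^sup>2 + (Im x)\<^sup>2 = 1" using assms by (simp flip: cmod_power2)
  then show ?thesis
    unfolding Re_divide cmod_power2 by (simp add: power2_eq_square algebra_simps flip: cmod_power2)
qed

text \<open>The angular limit is twice the infimum \<open>c\<close> of the quotient of \<open>Re q\<close> by the Poisson kernel \<open>K\<close>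
  of \<open>x\<close>. After subtracting \<open>c - e\<close> times the Cayley map of \<open>x\<close>, the real part is still positive but
  at some point \<open>w\<close> smaller than \<open>2 e K w\<close>; the Schwarz--Pick estimate propagates this smallness
  to every Stolz angle.\<close>

lemma angular_limit_nonneg_real_part:
  assumes holq: "q holomorphic_on unit_disc"
    and nonneg: "\<And>z. z \<in> unit_disc \<Longrightarrow> 0 \<le> Re (q z)"
    and x: "cmod x = 1"
  obtains c where "0 \<le> c" "has_angular_limit (\<lambda>z. q z * (x - z)) x (of_real c * x)"
proof -
  define K where "K z = (1 - (cmod z)\<^sup>2) / (cmod (x - z))\<^sup>2" for z
  have K: "0 < K z" if "z \<in> unit_disc" for z
    using that x unfolding K_def by (intro divide_pos_pos) (auto simp: abs_square_less_1)
  define c where "c = (INF z\<in>unit_disc. Re (q z) / K z)"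
  have bdd: "bdd_below ((\<lambda>z. Re (q z) / K z) ` unit_disc)"
    by (intro bdd_belowI2[where m = 0] divide_nonneg_nonneg nonneg less_imp_le K)
  have c_le: "c * K z \<le> Re (q z)" if "z \<in> unit_disc" for z
    using cINF_lower[OF bdd that] K[OF that] by (simp add: c_def field_simps)
  have "has_angular_limit (\<lambda>z. q z * (x - z)) x (of_real (2 * c) * x)"
    unfolding has_angular_limit_def
  proof (intro allI impI tendstoI)
    fix R \<epsilon> :: real assume R: "1 < R" and \<epsilon>: "0 < \<epsilon>"
    \<comment> \<open>The error left at \<open>x\<close> will be \<open>(8 * R + 2) * e\<close>, and
      \<open>8 * R + 2 < 11 * R\<close> because \<open>R > 1\<close>.\<close>
    define e where "e = \<epsilon> / (11 * R)"
    have e: "0 < e" using R \<epsilon> by (simp add: e_def)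
    \<comment> \<open>Taking \<open>c - e\<close> instead of \<open>c\<close> makes the real part
      strictly positive, as Schwarz--Pick requires, even if the infimum is attained.\<close>
    define f where "f z = q z - of_real (c - e) * ((x + z) / (x - z))" for z
    have holf: "f holomorphic_on unit_disc"
      unfolding f_def by (intro holomorphic_intros holq) (use x in auto)
    have Re_f: "Re (f z) = Re (q z) - (c - e) * K z" for z
      by (simp only: f_def minus_complex.simps Re_complex_of_real Im_complex_of_real
          times_complex.simps Re_cayley[OF x] K_def mult_zero_left diff_zero)
    have pos: "0 < Re (f z)" if "z \<in> unit_disc" for z
      using c_le[OF that] mult_pos_pos[OF e K[OF that]] by (simp add: Re_f algebra_simps)
    have "\<exists>w\<in>unit_disc. Re (q w) / K w < c + e"
      using cINF_less_iff[OF _ bdd, of "c + e"] e by (auto simp: c_def)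
    then obtain w where w: "w \<in> unit_disc" and "Re (q w) / K w < c + e" by blast
    then have fw: "Re (f w) \<le> 2 * e * K w"
      using K[OF w] by (simp add: Re_f field_simps)
    have w1: "cmod w < 1" and xw: "x \<noteq> w" using w x by auto
    \<comment> \<open>\<open>B\<close> is a bound with \<open>w\<close> fixed that is continuous at
      \<open>x\<close>. There its first and third terms vanish, and the second becomes
      \<open>8 * e * R\<close> since \<open>cmod (1 - cnj w * x) = cmod (x - w)\<close>.\<close>
    define B where "B z = cmod (f w) * cmod (x - z)
        + 8 * e * R * (cmod (1 - cnj w * z))\<^sup>2 / (cmod (x - w))\<^sup>2
        + \<bar>c\<bar> * cmod (z - x) + 2 * e" for z
    have bound: "dist (q z * (x - z)) (of_real (2 * c) * x) \<le> B z" if "z \<in> stolz_angle x R" for z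
    proof -
      have z: "z \<in> unit_disc" and z1: "cmod z < 1" and st: "cmod (x - z) < R * (1 - cmod z)"
        using that by (auto simp: stolz_angle_def)
      have xz: "x \<noteq> z" using z1 x by auto
      have p1: "0 < 1 - (cmod z)\<^sup>2" "0 < 1 - (cmod w)\<^sup>2"
        using z1 w1 by (auto simp: abs_square_less_1)
      have "(cmod z)\<^sup>2 \<le> cmod z" using z1 by (simp add: power2_eq_square mult_left_le)
      then have "R * (1 - cmod z) \<le> R * (1 - (cmod z)\<^sup>2)" using R by simp
      with st have st': "cmod (x - z) / (1 - (cmod z)\<^sup>2) \<le> R" using p1 by (simp add: field_simps)
      define D where "D = (cmod (1 - cnj w * z))\<^sup>2"
      have D: "0 \<le> D" by (simp add: D_def)
      have "cmod (f z - f w) * cmod (x - z)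
          \<le> (4 * Re (f w) * D / ((1 - (cmod z)\<^sup>2) * (1 - (cmod w)\<^sup>2))) * cmod (x - z)"
        unfolding D_def by (intro mult_right_mono schwarz_pick_right_half_plane holf pos w z) auto
      also have "\<dots> = 4 * Re (f w) * D / (1 - (cmod w)\<^sup>2) * (cmod (x - z) / (1 - (cmod z)\<^sup>2))"
        by simp
      also have "\<dots> \<le> 4 * (2 * e * K w) * D / (1 - (cmod w)\<^sup>2) * R"
        using p1 D fw e K[OF w] pos[OF w] R st'
        by (intro mult_mono divide_right_mono mult_left_mono mult_right_mono
            mult_nonneg_nonneg divide_nonneg_nonneg) auto
      \<comment> \<open>The factor \<open>1 - (cmod w)\<^sup>2\<close> of the Poisson kernel
        \<open>K w\<close> cancels the one from Schwarz--Pick, so a point \<open>w\<close> close to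
        the circle does no harm.\<close>
      also have "\<dots> = 8 * e * R * D / (cmod (x - w))\<^sup>2"
        using p1 xw by (simp add: K_def field_simps)
      finally have 1: "cmod (f z - f w) * cmod (x - z) \<le> 8 * e * R * D / (cmod (x - w))\<^sup>2" .
      \<comment> \<open>The Cayley term contributes \<open>(c - e) * (x + z)\<close>, which is split
        as \<open>2 * c * x + c * (z - x) - e * (x + z)\<close>.\<close>
      have "q z * (x - z) - of_real (2 * c) * x
          = f w * (x - z) + (f z - f w) * (x - z) + of_real c * (z - x) - of_real e * (x + z)"
        using xz by (simp add: f_def field_simps)
      also have "cmod \<dots> \<le> cmod (f w) * cmod (x - z) + cmod (f z - f w) * cmod (x - z)
          + \<bar>c\<bar> * cmod (z - x) + e * cmod (x + z)"
        using e by (intro order.trans[OF norm_triangle_ineq4] add_mono norm_triangle_le)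
          (auto simp: norm_mult)
      also have "e * cmod (x + z) \<le> e * 2"
        using e z1 x norm_triangle_ineq[of x z] by (intro mult_left_mono) auto
      finally show ?thesis
        using 1 by (simp add: B_def dist_norm D_def)
    qed
    have "cmod (1 - cnj w * x) = cmod (x - w)"
    proof -
      have "x * cnj x = 1" using x complex_norm_square[of x] by simp
      then have "1 - cnj w * x = x * cnj (x - w)" by (simp add: algebra_simps)
      then show ?thesis using x by (simp only: norm_mult complex_mod_cnj mult_1)
    qed
    then have "B x = (8 * R + 2) * e"
      using xw by (simp add: B_def field_simps)
    also have "\<dots> < \<epsilon>"
    proof -
      have "(8 * R + 2) * e < (11 * R) * e" using e R by (intro mult_strict_right_mono) auto
      also have "\<dots> = \<epsilon>" using R by (simp add: e_def)
      finally show ?thesis .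
    qed
    finally have Bx: "B x < \<epsilon>" .
    have "(B \<longlongrightarrow> B x) (at x within stolz_angle x R)"
      unfolding B_def using xw by (intro tendsto_intros) auto
    then have "eventually (\<lambda>z. B z < \<epsilon>) (at x within stolz_angle x R)"
      using Bx by (rule order_tendstoD)
    moreover have "eventually (\<lambda>z. z \<in> stolz_angle x R) (at x within stolz_angle x R)"
      by (simp add: eventually_at_filter)
    ultimately show "eventually (\<lambda>z. dist (q z * (x - z)) (of_real (2 * c) * x) < \<epsilon>)
        (at x within stolz_angle x R)"
      by eventually_elim (use bound in fastforce)
  qed
  moreover have "0 \<le> c"
    unfolding c_def by (intro cINF_greatest divide_nonneg_nonneg nonneg less_imp_le[OF K]) auto
  ultimately show thesis by (intro that[of "2 * c"]) auto
qed

text \<open>A zero of a nonconstant \<open>p\<close> would, by the open mapping theorem, put small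
  negative reals into its image.\<close>

lemma nonneg_real_part_nonzero:
  assumes holp: "p holomorphic_on unit_disc"
    and nonneg: "\<And>z. z \<in> unit_disc \<Longrightarrow> 0 \<le> Re (p z)"
    and nz: "w \<in> unit_disc" "p w \<noteq> 0"
    and z: "z \<in> unit_disc"
  shows "p z \<noteq> 0"
proof
  assume pz: "p z = 0"
  have "\<not> p constant_on unit_disc"
    using nz z pz unfolding constant_on_def by metis
  then have "open (p ` unit_disc)"
    by (intro open_mapping_thm[OF holp]) auto
  then obtain e where e: "0 < e" and sub: "cball 0 e \<subseteq> p ` unit_disc"
    using z pz unfolding open_contains_cball by (metis imageI)
  have "of_real (- e) \<in> p ` unit_disc"
    using e by (intro subsetD[OF sub]) auto
  then obtain u where "u \<in> unit_disc" "p u = of_real (- e)" by (metis imageE)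
  then show False using nonneg[of u] e by simp
qed

section \<open>Stolz angles and angular limits\<close>

lemma radial_in_stolz_angle:
  assumes "cmod x = 1" "1 < R" "0 < r" "r < 1"
  shows "of_real r * x \<in> stolz_angle x R"
proof -
  have "x - of_real r * x = of_real (1 - r) * x" by (simp add: algebra_simps)
  then have "cmod (x - of_real r * x) = 1 - r" using assms by (simp only: norm_mult norm_of_real) simp
  then show ?thesis using assms by (simp add: stolz_angle_def norm_mult)
qed

lemma filterlim_radial_stolz_angle:
  assumes "cmod x = 1" "1 < R"
  shows "filterlim (\<lambda>r. of_real r * x) (at x within stolz_angle x R) (at 1 within {0<..<1})"
  unfolding filterlim_at
proof (intro conjI)
  have "((\<lambda>r. of_real r * x) \<longlongrightarrow> of_real 1 * x) (at 1 within {0<..<1})"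
    by (intro tendsto_intros)
  then show "((\<lambda>r. of_real r * x) \<longlongrightarrow> x) (at 1 within {0<..<1})" by simp
  have "x \<noteq> 0" using assms by auto
  then show "eventually (\<lambda>r. of_real r * x \<in> stolz_angle x R \<and> of_real r * x \<noteq> x) (at 1 within {0<..<1})"
    using radial_in_stolz_angle[OF assms] by (auto simp: eventually_at_filter)
qed

text \<open>The radius to \<open>x\<close> lies in the angle. Nontriviality is what lets a limit
  determine the \<open>Liminf\<close>.\<close>

lemma stolz_angle_nontrivial:
  assumes "cmod x = 1" "1 < R"
  shows "at x within stolz_angle x R \<noteq> bot"
proof
  assume "at x within stolz_angle x R = bot"
  then have "(at (1::real) within {0<..<1}) = bot"
    using filterlim_radial_stolz_angle[OF assms] by (simp add: filterlim_def filtermap_bot_iff bot_unique)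
  then show False by (simp add: trivial_limit_within islimpt_greaterThanLessThan2)
qed


lemma has_angular_limitD:
  "has_angular_limit f x L \<Longrightarrow> 1 < R \<Longrightarrow> (f \<longlongrightarrow> L) (at x within stolz_angle x R)"
  by (simp add: has_angular_limit_def)

lemma has_angular_limit_continuous:
  "isCont f x \<Longrightarrow> has_angular_limit f x (f x)"
  unfolding has_angular_limit_def by (metis isContD tendsto_within_subset subset_UNIV)

lemma has_angular_limit_divide:
  assumes "has_angular_limit f x L" "has_angular_limit g x M" "M \<noteq> 0"
  shows "has_angular_limit (\<lambda>z. f z / g z) x (L / M)"
  using assms unfolding has_angular_limit_def by (blast intro: tendsto_divide)

lemma has_angular_limit_mult:
  assumes "has_angular_limit f x L" "has_angular_limit g x M"
  shows "has_angular_limit (\<lambda>z. f z * g z) x (L * M)"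
  using assms unfolding has_angular_limit_def by (blast intro: tendsto_mult)

lemma has_angular_limit_transform:
  assumes "has_angular_limit f x L" "\<And>z. z \<in> unit_disc \<Longrightarrow> f z = g z"
  shows "has_angular_limit g x L"
  unfolding has_angular_limit_def
proof (intro allI impI)
  fix R :: real assume "1 < R"
  with assms(1) have "(f \<longlongrightarrow> L) (at x within stolz_angle x R)" by (rule has_angular_limitD)
  then show "(g \<longlongrightarrow> L) (at x within stolz_angle x R)"
    by (rule Lim_transform_eventually)
      (use assms(2) in \<open>auto simp: eventually_at_filter stolz_angle_def\<close>)
qed

lemma angular_limit_imp_liminf:
  assumes lim: "has_angular_limit f x L" and x: "cmod x = 1" and R: "1 < R"
  shows "Liminf (at x within stolz_angle x R) (\<lambda>z. ereal (cmod (f z))) = ereal (cmod L)"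
  using stolz_angle_nontrivial[OF x R] tendsto_norm[OF has_angular_limitD[OF lim R]]
  by (intro lim_imp_Liminf) (auto intro: tendsto_ereal)

text \<open>This turns the pole condition into an equation for the modulus of a limit already known
  to exist.\<close>

lemma has_angular_liminf_iff:
  assumes "has_angular_limit f x L" "cmod x = 1"
  shows "has_angular_liminf (\<lambda>z. cmod (f z)) x C \<longleftrightarrow> cmod L = C"
  unfolding has_angular_liminf_def using angular_limit_imp_liminf[OF assms]
  by (metis ereal.inject gt_ex)

lemma angular_limit_imp_radial_limit:
  assumes "has_angular_limit f x L" "cmod x = 1"
  shows "((\<lambda>r. f (of_real r * x)) \<longlongrightarrow> L) (at 1 within {0<..<1})"
  by (rule filterlim_compose[OF has_angular_limitD[OF assms(1), of 2]
        filterlim_radial_stolz_angle[OF assms(2)]]) auto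

section \<open>The equivalence for a generator and its dual\<close>

theorem proposition5p3:
  fixes G Ghat :: "complex \<Rightarrow> complex" and \<tau> x :: complex and l :: real
  assumes "infinitesimal_generator G"
    and "\<exists>z\<in>unit_disc. G z \<noteq> 0"
    and "denjoy_wolff_point G \<tau>"
    and "dual_generator G \<tau> Ghat"
    and "x \<in> sphere 0 1 - {\<tau>}"
    and "0 < l"
  shows "(boundary_regular_null_point G x l \<and>
          ((\<lambda>r. cmod (G (complex_of_real r * x)) / (1 - r)) \<longlongrightarrow> l) (at 1 within {0<..<1}))
     \<longleftrightarrow> regular_pole Ghat x (cmod (\<tau> - x) ^ 4 / l)"
proof -
  have x: "cmod x = 1" and ne: "\<tau> \<noteq> x" using assms(5) by auto
  obtain p where holp: "p holomorphic_on unit_disc"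
    and nonneg: "\<And>z. z \<in> unit_disc \<Longrightarrow> 0 \<le> Re (p z)"
    and G: "\<And>z. z \<in> unit_disc \<Longrightarrow> G z = (\<tau> - z) * (1 - cnj \<tau> * z) * p z"
    and Ghat: "\<And>z. z \<in> unit_disc \<Longrightarrow> Ghat z = (\<tau> - z) * (1 - cnj \<tau> * z) * (1 / p z)"
    using assms(4) unfolding dual_generator_def berkson_porta_def by blast
  have pnz: "p z \<noteq> 0" if "z \<in> unit_disc" for z
    using assms(2) G that by (metis mult_zero_right nonneg_real_part_nonzero[OF holp nonneg])
  define m where "m z = (\<tau> - z) * (1 - cnj \<tau> * z)" for z
  define d where "d = cmod (\<tau> - x)"
  have d: "0 < d" using ne by (simp add: d_def)
  have xx: "x * cnj x = 1" using x complex_norm_square[of x] by simp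
  \<comment> \<open>The two added terms vanish on the unit circle; the remaining one contains the
    squared modulus of \<open>\<tau> - x\<close>.\<close>
  have "m x = - x * ((\<tau> - x) * cnj (\<tau> - x)) + \<tau> * (1 - x * cnj x) + x * (x * cnj x - 1)"
    by (simp add: m_def algebra_simps)
  then have mx: "m x = - x * of_real (d\<^sup>2)"
    unfolding xx complex_norm_square d_def by simp
  have m_lim: "has_angular_limit (\<lambda>z. - (m z)\<^sup>2) x (- (x\<^sup>2 * of_real (d ^ 4)))"
  proof -
    have "has_angular_limit (\<lambda>z. - (m z)\<^sup>2) x (- (m x)\<^sup>2)"
      unfolding m_def by (intro has_angular_limit_continuous continuous_intros)
    then show ?thesis by (simp add: mx power_mult_distrib flip: power_mult)
  qed
  have prod: "(Ghat z * (x - z)) * (G z / (z - x)) = - (m z)\<^sup>2" if "z \<in> unit_disc" for z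
  proof -
    have "z - x \<noteq> 0" using that x by auto
    then show ?thesis
      unfolding G[OF that] Ghat[OF that] m_def[symmetric]
      using pnz[OF that] by (simp add: power2_eq_square divide_simps) (simp add: algebra_simps)
  qed
  \<comment> \<open>If \<tau> lies in the disc, both factors vanish there. As division by 0 gives 0,
    the product formula can still be solved for either factor at every point of the disc.\<close>
  have zero_iff: "Ghat z * (x - z) = 0 \<longleftrightarrow> G z / (z - x) = 0" if "z \<in> unit_disc" for z
    using pnz[OF that] that x by (auto simp: G Ghat)
  have divide_eq: "c / a = b" "c / b = a" if "a * b = c" "a = 0 \<longleftrightarrow> b = 0" for a b c :: complex
    using that by auto
  show ?thesis
  proof (rule iffI; (elim conjE)?)
    assume "boundary_regular_null_point G x l"
    then have "has_angular_limit (\<lambda>z. G z / (z - x)) x (of_real l)"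
      by (simp add: boundary_regular_null_point_def)
    then have "has_angular_limit (\<lambda>z. - (m z)\<^sup>2 / (G z / (z - x))) x
        (- (x\<^sup>2 * of_real (d ^ 4)) / of_real l)"
      using m_lim assms(6) by (intro has_angular_limit_divide) auto
    moreover have "- (m z)\<^sup>2 / (G z / (z - x)) = Ghat z * (x - z)" if "z \<in> unit_disc" for z
      by (rule divide_eq(2)[OF prod[OF that] zero_iff[OF that]])
    ultimately have "has_angular_limit (\<lambda>z. Ghat z * (x - z)) x
        (- (x\<^sup>2 * of_real (d ^ 4)) / of_real l)"
      by (rule has_angular_limit_transform)
    moreover have "cmod (- (x\<^sup>2 * of_real (d ^ 4)) / of_real l) = d ^ 4 / l"
      using x d assms(6) by (simp add: norm_divide norm_mult norm_power)
    ultimately have "has_angular_liminf (\<lambda>z. cmod (Ghat z * (x - z))) x (d ^ 4 / l)"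
      using has_angular_liminf_iff x by blast
    then show "regular_pole Ghat x (cmod (\<tau> - x) ^ 4 / l)"
      using x d assms(6) by (simp add: regular_pole_def flip: d_def)
  next
    assume pole: "regular_pole Ghat x (cmod (\<tau> - x) ^ 4 / l)"
    have "0 \<le> Re (1 / p z)" if "z \<in> unit_disc" for z
      using nonneg[OF that] by (simp add: Re_divide)
    moreover have "(\<lambda>z. 1 / p z) holomorphic_on unit_disc"
      by (intro holomorphic_intros holp pnz)
    ultimately obtain c where "0 \<le> c"
      and q_lim: "has_angular_limit (\<lambda>z. 1 / p z * (x - z)) x (of_real c * x)"
      using angular_limit_nonneg_real_part[of "\<lambda>z. 1 / p z"] x by blast
    have "has_angular_limit m x (m x)"
      unfolding m_def by (intro has_angular_limit_continuous continuous_intros)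
    from has_angular_limit_mult[OF this q_lim]
    have "has_angular_limit (\<lambda>z. m z * (1 / p z * (x - z))) x (m x * (of_real c * x))" .
    then have lim: "has_angular_limit (\<lambda>z. Ghat z * (x - z)) x (m x * (of_real c * x))"
      by (rule has_angular_limit_transform) (simp add: Ghat m_def)
    then have "cmod (m x * (of_real c * x)) = d ^ 4 / l"
      using pole x has_angular_liminf_iff unfolding regular_pole_def d_def by blast
    \<comment> \<open>Since \<open>c \<ge> 0\<close>, no phase is lost in taking moduli, so the mass
      determines \<open>c\<close> and with it the full complex limit.\<close>
    then have "d\<^sup>2 * c = d ^ 4 / l"
      using x \<open>0 \<le> c\<close> by (simp add: mx norm_mult norm_power)
    moreover have "d ^ 4 / l = d\<^sup>2 * (d\<^sup>2 / l)"
      by (simp add: power2_eq_square power4_eq_xxxx)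
    ultimately have "d\<^sup>2 * c = d\<^sup>2 * (d\<^sup>2 / l)" by (rule trans)
    then have "c = d\<^sup>2 / l"
      using d unfolding mult_cancel_left by simp
    then have val: "m x * (of_real c * x) = - (x\<^sup>2 * of_real (d ^ 4)) / of_real l"
      by (simp add: mx power2_eq_square power4_eq_xxxx)
    have "x \<noteq> 0" using x by auto
    then have nonzero: "- (x\<^sup>2 * of_real (d ^ 4)) / of_real l \<noteq> 0"
      using d assms(6) by simp
    have "- (x\<^sup>2 * of_real (d ^ 4)) / (- (x\<^sup>2 * of_real (d ^ 4)) / of_real l) = of_real l"
      using \<open>x \<noteq> 0\<close> d assms(6) by simp
    with has_angular_limit_divide[OF m_lim lim[unfolded val] nonzero]
    have "has_angular_limit (\<lambda>z. - (m z)\<^sup>2 / (Ghat z * (x - z))) x (of_real l)"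
      by (simp only:)
    moreover have "- (m z)\<^sup>2 / (Ghat z * (x - z)) = G z / (z - x)" if "z \<in> unit_disc" for z
      by (rule divide_eq(1)[OF prod[OF that] zero_iff[OF that]])
    ultimately have limG: "has_angular_limit (\<lambda>z. G z / (z - x)) x (of_real l)"
      by (rule has_angular_limit_transform)
    \<comment> \<open>The radial limit is the modulus of the angular one along the radius, where the
      distance from \<open>x\<close> is \<open>1 - r\<close>.\<close>
    have radial: "((\<lambda>r. cmod (G (of_real r * x) / (of_real r * x - x))) \<longlongrightarrow> cmod (of_real l))
        (at 1 within {0<..<1})"
      by (intro tendsto_norm angular_limit_imp_radial_limit[OF limG x])
    have radial_eq:
      "cmod (G (of_real r * x) / (of_real r * x - x)) = cmod (G (of_real r * x)) / (1 - r)"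
      if "r \<in> {0<..<1}" for r
    proof -
      have "of_real r * x - x = of_real (r - 1) * x" by (simp add: algebra_simps)
      then have "cmod (of_real r * x - x) = 1 - r"
        using x that by (simp only: norm_mult norm_of_real) simp
      then show ?thesis by (simp add: norm_divide)
    qed
    have "((\<lambda>r. cmod (G (of_real r * x)) / (1 - r)) \<longlongrightarrow> cmod (of_real l))
        (at 1 within {0<..<1})"
      by (rule Lim_transform_eventually[OF radial])
        (simp add: eventually_at_filter radial_eq del: of_real_diff)
    then show "boundary_regular_null_point G x l \<and>
        ((\<lambda>r. cmod (G (of_real r * x)) / (1 - r)) \<longlongrightarrow> l) (at 1 within {0<..<1})"
      using limG x assms(6) by (simp add: boundary_regular_null_point_def)
  qed
qed

end
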